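(* There is no deterministic online algorithm for dynamic queues with competitive ratio smaller than $1.6329$; this holds even in the decremental case.
   Context: Dynamic set problem: each item $x$ has a weight $w_x\ge 0$; time proceeds in steps; before each step items may be inserted into or deleted from a dynamic set $\mathcal{S}$; an item is active if inserted and not yet deleted; at each step an algorithm may collect at most one active item it has not collected before (pending items); the gain is the total weight collected. Online algorithms decide knowing only past insertions/deletions. A deterministic online algorithm is $R$-competitive if on every instance its gain is at least $\mathrm{OPT}/R$ ($\mathrm{OPT}$ = maximum achievable gain); the competitive ratio is the infimum of such $R$. Dynamic queue: $\mathcal{S}$ is a linearly ordered list; items may be inserted at any position, but only a prefix of the current list may be deleted. Decremental: all items are inserted before the first step, afterwards only deletions occur. *)

theory Defs
  imports Complex_Main "HOL-Library.Extended_Real"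
begin

text \<open>Items are told apart by an identifier, so that any number of items may share a weight.\<close>

datatype item = Item (ident: nat) (weight: real)

datatype update = Insert nat item | DeletePrefix nat

text \<open>\<^term>\<open>Insert i x\<close> puts \<^term>\<open>x\<close> in front of the element with (0-based) index \<^term>\<open>i\<close>, or at
  the end if \<^term>\<open>i\<close> is the length of the list.\<close>

fun apply_update :: "item list \<Rightarrow> update \<Rightarrow> item list" where
  "apply_update q (Insert i x) = take i q @ x # drop i q"
| "apply_update q (DeletePrefix k) = drop k q"

definition queue :: "update list \<Rightarrow> item list" where
  "queue us = foldl apply_update [] us"

definition inserted :: "update list \<Rightarrow> item list" where
  "inserted us = concat (map (\<lambda>u. case u of Insert i x \<Rightarrow> [x] | DeletePrefix k \<Rightarrow> []) us)"

text \<open>Every item is inserted at most once, even after it has been deleted.\<close>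

definition legal :: "update list \<Rightarrow> bool" where
  "legal us \<longleftrightarrow>
     distinct (inserted us) \<and>
     (\<forall>x \<in> set (inserted us). 0 \<le> weight x) \<and>
     (\<forall>n < length us.
        case us ! n of
          Insert i x \<Rightarrow> i \<le> length (queue (take n us))
        | DeletePrefix k \<Rightarrow> k \<le> length (queue (take n us)))"

text \<open>The \<^term>\<open>t\<close>-th element of an instance is the batch of updates performed, in this order, just
  before step \<^term>\<open>t\<close>; steps are numbered from 0, and nothing can be collected after the last
  one. Collected items stay in the list until they are deleted: the list does not depend on what an
  algorithm does.\<close>

type_synonym problem_instance = "update list list"

definition dynamic_queue :: "problem_instance set" where
  "dynamic_queue = {I. legal (concat I)}"

definition decremental_queue :: "problem_instance set" where
  "decremental_queue =
     {I \<in> dynamic_queue. \<forall>us \<in> set (tl I). \<forall>u \<in> set us. \<exists>k. u = DeletePrefix k}"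

definition active :: "problem_instance \<Rightarrow> nat \<Rightarrow> item set" where
  "active I t = set (queue (concat (take (Suc t) I)))"

text \<open>A schedule says what is collected in each step; only its values on the steps of the instance
  matter.\<close>

type_synonym schedule = "nat \<Rightarrow> item option"

definition pending :: "problem_instance \<Rightarrow> schedule \<Rightarrow> nat \<Rightarrow> item set" where
  "pending I c t = {x \<in> active I t. \<forall>s < t. c s \<noteq> Some x}"

definition feasible :: "problem_instance \<Rightarrow> schedule \<Rightarrow> bool" where
  "feasible I c \<longleftrightarrow> (\<forall>t < length I. \<forall>x. c t = Some x \<longrightarrow> x \<in> pending I c t)"

definition gain :: "problem_instance \<Rightarrow> schedule \<Rightarrow> real" where
  "gain I c = (\<Sum>t < length I. case c t of None \<Rightarrow> 0 | Some x \<Rightarrow> weight x)"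

definition OPT :: "problem_instance \<Rightarrow> real" where
  "OPT I = Max {gain I c | c. feasible I c}"

text \<open>A deterministic online algorithm maps the updates seen so far to its decision in the current
  step. It need not be given its own earlier decisions, since they are determined by the earlier
  updates. It does not know whether the current step is the last one.\<close>

type_synonym algorithm = "update list list \<Rightarrow> item option"

definition run :: "algorithm \<Rightarrow> problem_instance \<Rightarrow> schedule" where
  "run A I t = A (take (Suc t) I)"

definition online_algorithm :: "problem_instance set \<Rightarrow> algorithm \<Rightarrow> bool" where
  "online_algorithm C A \<longleftrightarrow> (\<forall>I \<in> C. feasible I (run A I))"

definition competitive :: "problem_instance set \<Rightarrow> algorithm \<Rightarrow> real \<Rightarrow> bool" where
  "competitive C A R \<longleftrightarrow> 0 < R \<and> (\<forall>I \<in> C. OPT I / R \<le> gain I (run A I))"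

text \<open>The value is \<open>\<infinity>\<close> if the algorithm is not \<open>R\<close>-competitive for any \<open>R\<close>.\<close>

definition competitive_ratio :: "problem_instance set \<Rightarrow> algorithm \<Rightarrow> ereal" where
  "competitive_ratio C A = Inf {ereal R | R. competitive C A R}"

text \<open>The maximum in \<^const>\<open>OPT\<close> is taken over a finite nonempty set.\<close>

lemma set_queue_subset: "set (queue us) \<subseteq> set (inserted us)"
proof (induction us rule: rev_induct)
  case Nil
  show ?case by (simp add: queue_def)
next
  case (snoc u us)
  then show ?case
    by (cases u) (auto simp: queue_def inserted_def dest: in_set_takeD in_set_dropD)
qed

lemma active_subset: "active I t \<subseteq> set (inserted (concat I))"
proof -
  have "set (inserted (concat (take (Suc t) I))) \<subseteq> set (inserted (concat I))"
    by (auto simp: inserted_def dest!: in_set_takeD)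
  then show ?thesis
    using set_queue_subset unfolding active_def by blast
qed

lemma finite_gains: "finite {gain I c | c. feasible I c}"
proof -
  define V where "V = insert None (Some ` set (inserted (concat I)))"
  define g where
    "g l = (\<Sum>t < length I. case l ! t of None \<Rightarrow> 0 | Some x \<Rightarrow> weight x)" for l
  have "gain I c \<in> g ` {l. set l \<subseteq> V \<and> length l = length I}" if "feasible I c" for c
  proof
    show "gain I c = g (map c [0..<length I])"
      by (simp add: gain_def g_def)
    have "c t \<in> V" if "t < length I" for t
    proof (cases "c t")
      case (Some x)
      then have "x \<in> active I t"
        using \<open>feasible I c\<close> that by (simp add: feasible_def pending_def)
      then show ?thesis
        using active_subset[of I t] Some by (auto simp: V_def)
    qed (simp add: V_def)
    then show "map c [0..<length I] \<in> {l. set l \<subseteq> V \<and> length l = length I}"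
      by auto
  qed
  then have "{gain I c | c. feasible I c} \<subseteq> g ` {l. set l \<subseteq> V \<and> length l = length I}"
    by blast
  moreover have "finite {l. set l \<subseteq> V \<and> length l = length I}"
    by (rule finite_lists_length_eq) (simp add: V_def)
  ultimately show ?thesis
    by (meson finite_imageI finite_subset)
qed

lemma gains_nonempty: "{gain I c | c. feasible I c} \<noteq> {}"
  by (auto simp: feasible_def intro!: exI[of _ "\<lambda>_. None"])

end

theory Submission
  imports Defs
begin

text \<open>The list holds six items \<open>x\<^sub>0, \<dots>, x\<^sub>5\<close>, with weights that are not sorted. The adversary
  stops as soon as the algorithm collects an item so light that the optimum, taking the heaviest
  items at once, is far enough ahead. Otherwise the adversary keeps deleting light items at the
  front, which the optimum manages to collect first, and finally lets the optimum collect the heavy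
  items while the algorithm, which already has them, gains nothing.

  Making all outcomes equally bad for the algorithm, with the weight of \<open>x\<^sub>5\<close> normalised to 1, gives
  the weights \<open>1/R\<close>, \<open>2 - R\<close>, \<open>1/R\<^sup>2 + 1/R + 2 - R\<^sup>2\<close>, \<open>R\<^sup>2 - R - 1/R\<close>, \<open>R - 1\<close>, \<open>1\<close>, where \<open>R\<close>,
  about 1.63297, is a root of \<open>R\<^sup>5 + R\<^sup>3 - 5 R\<^sup>2 - R - 1\<close>. The weights below are these, multiplied by
  100000 and rounded.\<close>

definition depletion :: "item list \<Rightarrow> nat list \<Rightarrow> problem_instance" where
  "depletion xs ks = map (Insert 0) (rev xs) # map (\<lambda>k. [DeletePrefix k]) ks"

definition collected_weight :: "item option \<Rightarrow> real" where
  "collected_weight c = (case c of None \<Rightarrow> 0 | Some x \<Rightarrow> weight x)"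

lemma collected_weight_simps [simp]:
  "collected_weight None = 0" "collected_weight (Some x) = weight x"
  by (simp_all add: collected_weight_def)

lemma length_depletion [simp]: "length (depletion xs ks) = Suc (length ks)"
  by (simp add: depletion_def)

text \<open>What is seen online up to step \<open>t\<close> is again a depletion, so the algorithm's
  decisions are indexed by the prefixes of \<open>ks\<close>.\<close>

lemma take_depletion: "take (Suc t) (depletion xs ks) = depletion xs (take t ks)"
  by (simp add: depletion_def take_map)

lemma concat_depletion:
  "concat (depletion xs ks) = map (Insert 0) (rev xs) @ map DeletePrefix ks"
  by (induction ks) (auto simp: depletion_def)

lemma queue_inserts: "queue (map (Insert 0) xs) = rev xs"
  by (induction xs rule: rev_induct) (auto simp: queue_def)

lemma foldl_deletes: "foldl apply_update q (map DeletePrefix ks) = drop (sum_list ks) q"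
  by (induction ks arbitrary: q) (auto simp: add.commute)

lemma queue_depletion: "queue (concat (depletion xs ks)) = drop (sum_list ks) xs"
  using queue_inserts[of "rev xs"]
  by (simp add: concat_depletion queue_def foldl_deletes)

lemma active_depletion: "active (depletion xs ks) t = set (drop (sum_list (take t ks)) xs)"
  by (simp add: active_def take_depletion queue_depletion)

lemma depletion_decremental:
  assumes "distinct xs" "\<forall>x \<in> set xs. 0 \<le> weight x" "sum_list ks \<le> length xs"
  shows "depletion xs ks \<in> decremental_queue"
proof -
  let ?us = "concat (depletion xs ks)"
  have ins: "inserted ?us = rev xs"
  proof -
    have "inserted (map (Insert 0) ys @ map DeletePrefix ks) = ys" for ys
      by (induction ys) (auto simp: inserted_def)
    then show ?thesis by (simp only: concat_depletion)
  qed
  have pos: "case ?us ! n of Insert i x \<Rightarrow> i \<le> length (queue (take n ?us))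
        | DeletePrefix k \<Rightarrow> k \<le> length (queue (take n ?us))" if "n < length ?us" for n
  proof (cases "n < length xs")
    case True
    then show ?thesis by (simp add: concat_depletion nth_append)
  next
    case False
    define m where "m = n - length xs"
    have m: "m < length ks" "n = length xs + m"
      using that False by (auto simp: m_def concat_depletion)
    \<comment> \<open>The updates before a deletion form a shorter depletion, so
      \<open>queue_depletion\<close> gives the list they leave.\<close>
    have "take n ?us = concat (depletion xs (take m ks))"
      using m by (simp add: concat_depletion take_map)
    moreover have "sum_list ks = sum_list (take m ks) + ks ! m + sum_list (drop (Suc m) ks)"
      using m by (metis add.assoc append_take_drop_id Cons_nth_drop_Suc sum_list.Cons sum_list_append)
    ultimately show ?thesis
      using m assms(3) by (simp only: queue_depletion) (simp add: concat_depletion nth_append)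
  qed
  have "legal ?us"
    unfolding legal_def ins using assms pos by auto
  then show ?thesis
    by (auto simp: decremental_queue_def dynamic_queue_def depletion_def)
qed

text \<open>Feasibility in the last step of the instance; it limits the branches of the adversary's
  case analysis to pending items.\<close>

lemma online_feasible_depletion:
  assumes "online_algorithm C A" "decremental_queue \<subseteq> C"
    and "distinct xs" "\<forall>x \<in> set xs. 0 \<le> weight x" "sum_list ks \<le> length xs"
    and "A (depletion xs ks) = Some x"
  shows "x \<in> set (drop (sum_list ks) xs)"
    and "t < length ks \<Longrightarrow> A (depletion xs (take t ks)) \<noteq> Some x"
proof -
  have "feasible (depletion xs ks) (run A (depletion xs ks))"
    using assms(1-5) depletion_decremental unfolding online_algorithm_def by blast
  then have "x \<in> pending (depletion xs ks) (run A (depletion xs ks)) (length ks)"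
    using assms(6) by (simp add: feasible_def run_def take_depletion)
  then show "x \<in> set (drop (sum_list ks) xs)"
    and "t < length ks \<Longrightarrow> A (depletion xs (take t ks)) \<noteq> Some x"
    by (auto simp: pending_def active_depletion run_def take_depletion)
qed

lemma gain_le_OPT: "feasible I c \<Longrightarrow> gain I c \<le> OPT I"
  unfolding OPT_def by (rule Max_ge[OF finite_gains]) auto

text \<open>The adversary may stop after any step, and the schedule \<open>cs\<close> then bounds
  \<open>OPT\<close> from below. Its positive weight forces a positive online gain, which makes the
  bound strict for \<open>\<rho>\<close>.\<close>

lemma competitive_depletion:
  assumes "competitive C A R" "R < \<rho>" "decremental_queue \<subseteq> C"
    and "distinct xs" "\<forall>x \<in> set xs. 0 \<le> weight x" "sum_list ks \<le> length xs"
    and "length cs = Suc (length ks)" "distinct cs"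
    and "\<forall>t < length cs. cs ! t \<in> set (drop (sum_list (take t ks)) xs)"
    and "0 < sum_list (map weight cs)"
  shows "sum_list (map weight cs)
    < \<rho> * (\<Sum>t < Suc (length ks). collected_weight (A (depletion xs (take t ks))))"
proof -
  let ?I = "depletion xs ks" and ?c = "\<lambda>t. Some (cs ! t)"
  let ?g = "\<Sum>t < Suc (length ks). collected_weight (A (depletion xs (take t ks)))"
  have "feasible ?I ?c"
    using assms(7-9) by (auto simp: feasible_def pending_def active_depletion nth_eq_iff_index_eq)
  moreover have "gain ?I ?c = sum_list (map weight cs)"
    using assms(7) by (simp add: gain_def sum_list_sum_nth atLeast0LessThan)
  moreover have "?I \<in> C"
    using assms(3-6) depletion_decremental by blast
  moreover have "gain ?I (run A ?I) = ?g"
    by (simp add: gain_def run_def take_depletion collected_weight_def)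
  moreover have R: "0 < R"
    using assms(1) by (simp add: competitive_def)
  ultimately have "sum_list (map weight cs) / R \<le> ?g"
    using assms(1) gain_le_OPT[of ?I ?c] unfolding competitive_def
    by (metis divide_right_mono less_imp_le order_trans)
  then have le: "sum_list (map weight cs) \<le> R * ?g"
    using R by (simp add: pos_divide_le_eq mult.commute)
  then have "0 < ?g"
    using R assms(10) by (metis less_le_trans zero_less_mult_pos)
  then have "R * ?g < \<rho> * ?g"
    using assms(2) by simp
  with le show ?thesis by simp
qed

text \<open>The gap between 1.6329 and the root near 1.63297 absorbs the rounding: each inequality
  refuted below fails by at least 4 units.\<close>

definition hard_items :: "item list" where
  "hard_items = [Item 0 61238, Item 1 36703, Item 2 32082, Item 3 42123, Item 4 63297, Item 5 100000]"

text \<open>The adversary uses decremental instances only, so one argument serves every class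
  \<open>C\<close> containing them.\<close>

lemma not_competitive_below:
  assumes C: "decremental_queue \<subseteq> C" and online: "online_algorithm C A"
    and comp: "competitive C A R" and R: "R < 1.6329"
  shows False
proof -
  define p where "p ks = A (depletion hard_items ks)" for ks
  have items: "distinct hard_items" "\<forall>x \<in> set hard_items. 0 \<le> weight x" "length hard_items = 6"
    by (simp_all add: hard_items_def)
  \<comment> \<open>\<open>js\<close> lists the indices of the items that a competing schedule collects.\<close>
  have lead: "sum_list (map (weight \<circ> (!) hard_items) js)
      < 1.6329 * (\<Sum>t < Suc (length ks). collected_weight (p (take t ks)))"
    if "sum_list ks \<le> 6" "length js = Suc (length ks)" "distinct js"
      "list_all2 (\<lambda>t i. sum_list (take t ks) \<le> i \<and> i < 6) [0..<Suc (length ks)] js" for ks js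
  proof -
    have i: "sum_list (take t ks) \<le> js ! t" "js ! t < 6" if "t < length js" for t
      using \<open>list_all2 _ _ _\<close> \<open>length js = _\<close> that by (auto simp: list_all2_conv_all_nth simp del: upt_Suc)
    then have lt: "\<forall>i \<in> set js. i < 6"
      by (metis in_set_conv_nth)
    have pos: "0 < weight (hard_items ! i)" if "i < 6" for i
      using that by (auto simp: hard_items_def less_Suc_eq numeral_eq_Suc)
    show ?thesis
      unfolding p_def list.map_comp[symmetric]
    proof (rule competitive_depletion[OF comp R C items(1,2)])
      show "distinct (map ((!) hard_items) js)"
        using \<open>distinct js\<close> lt items by (auto simp: distinct_map inj_on_def nth_eq_iff_index_eq)
      show "\<forall>t < length (map ((!) hard_items) js). map ((!) hard_items) js ! t
          \<in> set (drop (sum_list (take t ks)) hard_items)"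
      proof (intro allI impI)
        fix t assume "t < length (map ((!) hard_items) js)"
        then have "sum_list (take t ks) \<le> js ! t" "js ! t < 6" "t < length js"
          using i by auto
        then show "map ((!) hard_items) js ! t \<in> set (drop (sum_list (take t ks)) hard_items)"
          using items by (auto simp: in_set_conv_nth intro!: exI[of _ "js ! t - sum_list (take t ks)"])
      qed
      show "0 < sum_list (map weight (map ((!) hard_items) js))"
        using pos lt \<open>length js = _\<close>
        by (cases js) (auto simp: less_imp_le intro!: add_pos_nonneg sum_list_nonneg)
    qed (use that items in auto)
  qed

  have choice: "p ks = None \<or>
      p ks \<in> Some ` set (drop (sum_list ks) hard_items) - (\<lambda>t. p (take t ks)) ` {..<length ks}"
    if "sum_list ks \<le> 6" for ks
    using online_feasible_depletion[OF online C items(1,2), of ks] that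
    by (cases "p ks") (force simp: p_def items(3))+
  have idle: "p ks = None"
    if "sum_list ks \<le> 6"
      "Some ` set (drop (sum_list ks) hard_items) \<subseteq> (\<lambda>t. p (take t ks)) ` {..<length ks}" for ks
    using choice[OF that(1)] that(2) by blast

  \<comment> \<open>The first item must weigh more than 61240; \<open>x\<^sub>0\<close> just
    fails.\<close>
  have "100000 < 1.6329 * collected_weight (p [])"
    using lead[of "[]" "[5]"] by (simp add: hard_items_def)
  then consider "p [] = Some (Item 4 63297)" | "p [] = Some (Item 5 100000)"
    using choice[of "[]"] by (auto simp: hard_items_def)
  then show False
  proof cases
    case 2
    \<comment> \<open>Only \<open>x\<^sub>5\<close> survives, already collected, whereas the
      competitor takes \<open>x\<^sub>4\<close> just before its deletion.\<close>
    then have "p [5] = None"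
      by (intro idle) (simp_all add: hard_items_def lessThan_Suc del: One_nat_def)
    then show False
      using lead[of "[5]" "[4, 5]"] 2 by (simp add: hard_items_def)
  next
    case p0: 1
    \<comment> \<open>The second item must weigh more than 36707; \<open>x\<^sub>1\<close> just
      fails.\<close>
    have "163297 < 1.6329 * (63297 + collected_weight (p [1]))"
      using lead[of "[1]" "[4, 5]"] p0 by (simp add: hard_items_def)
    then consider "p [1] = Some (Item 3 42123)" | "p [1] = Some (Item 5 100000)"
      using choice[of "[1]"] p0 by (auto simp: hard_items_def lessThan_Suc)
    then show False
    proof cases
      case p1: 2
      \<comment> \<open>Only collected items survive. The entry 0 adds a step without deletion, so
        that the competitor can take both \<open>x\<^sub>4\<close> and
        \<open>x\<^sub>5\<close>.\<close>
      have "p [1, 3] = None"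
        by (intro idle) (simp_all add: hard_items_def lessThan_Suc p0 p1 del: One_nat_def)
      moreover have "p [1, 3, 0] = None"
        by (intro idle) (simp_all add: hard_items_def lessThan_Suc p0 p1 del: One_nat_def)
      ultimately show False
        using lead[of "[1, 3, 0]" "[0, 3, 4, 5]"] p0 p1 by (simp add: hard_items_def)
    next
      case p1: 1
      \<comment> \<open>The third item must weigh more than 32086; \<open>x\<^sub>2\<close> just
        fails.\<close>
      have "224535 < 1.6329 * (105420 + collected_weight (p [1, 1]))"
        using lead[of "[1, 1]" "[0, 4, 5]"] p0 p1 by (simp add: hard_items_def)
      then have p2: "p [1, 1] = Some (Item 5 100000)"
        using choice[of "[1, 1]"] p0 p1 by (auto simp: hard_items_def lessThan_Suc)
      \<comment> \<open>All survivors are collected, while the competitor took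
        \<open>x\<^sub>0\<close>, \<open>x\<^sub>1\<close>, \<open>x\<^sub>2\<close> each just
        before its deletion and ends up with all six items.\<close>
      have "p [1, 1, 1] = None"
        by (intro idle) (simp_all add: hard_items_def lessThan_Suc p0 p1 p2 del: One_nat_def)
      moreover have "p [1, 1, 1, 0] = None"
        by (intro idle) (simp_all add: hard_items_def lessThan_Suc p0 p1 p2 del: One_nat_def)
      moreover have "p [1, 1, 1, 0, 0] = None"
        by (intro idle) (simp_all add: hard_items_def lessThan_Suc p0 p1 p2 del: One_nat_def)
      ultimately show False
        using lead[of "[1, 1, 1, 0, 0]" "[0, 1, 2, 3, 4, 5]"] p0 p1 p2
        by (simp add: hard_items_def)
    qed
  qed
qed

theorem theorem3:
  "\<not> (\<exists>A. online_algorithm dynamic_queue A \<and>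
           competitive_ratio dynamic_queue A < ereal 1.6329) \<and>
   \<not> (\<exists>A. online_algorithm decremental_queue A \<and>
           competitive_ratio decremental_queue A < ereal 1.6329)"
proof -
  have "\<not> competitive_ratio C A < ereal 1.6329"
    if "decremental_queue \<subseteq> C" "online_algorithm C A" for C A
    using not_competitive_below[OF that] by (auto simp: competitive_ratio_def Inf_less_iff)
  moreover have "decremental_queue \<subseteq> dynamic_queue"
    by (auto simp: decremental_queue_def)
  ultimately show ?thesis by blast
qed

end
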